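(* For $k=0,1,2,\ldots$ let $l_k=\tfrac{1}{2^k}$, $t_k=\tfrac12(l_{k+1}+l_k)$ and $s_k=1+2^{-2k}$, and let $p_k$ be the unique polynomial of degree at most nine satisfying the ten conditions: $p_k$ and $-t^2$ agree up to and including their respective third derivatives at $t=l_{k+1}$ and at $t=l_k$; $p_k(t_k)=-t_k^2$; and $p_k'(t_k)=s_k\cdot(-2t_k)$. Define $f_1:[-1,1]\to\mathbb{R}$ by $$f_1(t)=\begin{cases} p_k(t) & \text{if } t\in[l_{k+1},l_k] \text{ for } k=0,1,2,\ldots,\\ -t^2 & \text{if } t\in[-1,0],\end{cases}$$ let $f_2(t)=f_1(-t)$ for $t\in[-1,1]$, and let $f_{\max}=\max(f_1,f_2)$. Then $f_1$ and $f_2$ are $\mathcal{C}^3$, $t=0$ is an isolated maximizer of $f_{\max}$, and $f_{\max}$ is differentiable at $t=0$ with $f_{\max}'(0)=0$; but $t_k\to0$ as $k\to\infty$ and $f_{\max}$ is nondifferentiable at every $t_k$. Hence $f_{\max}$ is not $\mathcal{C}^1$ at $t=0$.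
   Context: $\mathcal{C}^q$ means $q$-times continuously differentiable (with one-sided derivatives at the endpoints $\pm1$ of the domain). A (local) maximizer of a function is isolated if some neighborhood of it contains no other local maximizer of the function. $\max(f_1,f_2)$ is the pointwise maximum. *)

theory Defs
  imports "HOL-Analysis.Analysis" "HOL-Computational_Algebra.Polynomial"
begin

text \<open>
  \<open>D j\<close> is the \<open>j\<close>-th derivative. Derivatives are taken within \<open>S\<close>, so they are one-sided at the
  endpoints of a closed interval, and values of \<open>f\<close> outside \<open>S\<close> are irrelevant.
\<close>
definition Cq_on :: "nat \<Rightarrow> (real \<Rightarrow> real) \<Rightarrow> real set \<Rightarrow> bool" where
  "Cq_on q f S \<longleftrightarrow>
     (\<exists>D :: nat \<Rightarrow> real \<Rightarrow> real.
        (\<forall>t\<in>S. D 0 t = f t) \<and>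
        (\<forall>j<q. \<forall>t\<in>S. (D j has_real_derivative D (Suc j) t) (at t within S)) \<and>
        continuous_on S (D q))"

definition Cq_at_on :: "nat \<Rightarrow> (real \<Rightarrow> real) \<Rightarrow> real set \<Rightarrow> real \<Rightarrow> bool" where
  "Cq_at_on q f S x \<longleftrightarrow> (\<exists>U. open U \<and> x \<in> U \<and> Cq_on q f (U \<inter> S))"

definition local_maximizer_on :: "(real \<Rightarrow> real) \<Rightarrow> real set \<Rightarrow> real \<Rightarrow> bool" where
  "local_maximizer_on f S x \<longleftrightarrow>
     x \<in> S \<and> (\<exists>U. open U \<and> x \<in> U \<and> (\<forall>y \<in> U \<inter> S. f y \<le> f x))"

definition isolated_local_maximizer_on :: "(real \<Rightarrow> real) \<Rightarrow> real set \<Rightarrow> real \<Rightarrow> bool" where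
  "isolated_local_maximizer_on f S x \<longleftrightarrow>
     local_maximizer_on f S x \<and>
     (\<exists>U. open U \<and> x \<in> U \<and> (\<forall>y \<in> U \<inter> S. local_maximizer_on f S y \<longrightarrow> y = x))"

definition l_seq :: "nat \<Rightarrow> real" where
  "l_seq k = 1 / 2 ^ k"

definition t_seq :: "nat \<Rightarrow> real" where
  "t_seq k = 1 / 2 * (l_seq (k + 1) + l_seq k)"

definition s_seq :: "nat \<Rightarrow> real" where
  "s_seq k = 1 + 1 / 2 ^ (2 * k)"

definition p_conditions :: "nat \<Rightarrow> real poly \<Rightarrow> bool" where
  "p_conditions k P \<longleftrightarrow>
     degree P \<le> 9 \<and>
     (\<forall>j\<le>3. (deriv ^^ j) (poly P) (l_seq (k + 1)) = (deriv ^^ j) (\<lambda>t. - t\<^sup>2) (l_seq (k + 1))) \<and>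
     (\<forall>j\<le>3. (deriv ^^ j) (poly P) (l_seq k) = (deriv ^^ j) (\<lambda>t. - t\<^sup>2) (l_seq k)) \<and>
     poly P (t_seq k) = - (t_seq k)\<^sup>2 \<and>
     deriv (poly P) (t_seq k) = s_seq k * (- 2 * t_seq k)"

definition p_poly :: "nat \<Rightarrow> real poly" where
  "p_poly k = (THE P. p_conditions k P)"

text \<open>
  Only the values on \<open>{-1..1}\<close> matter. At a breakpoint \<open>l_seq k\<close> with \<open>k > 0\<close> two indices qualify;
  that both pieces give the same value there is part of the theorem, not of the definition.
\<close>
definition f1 :: "real \<Rightarrow> real" where
  "f1 t = (if t \<le> 0 then - t\<^sup>2
           else poly (p_poly (SOME k. t \<in> {l_seq (k + 1)..l_seq k})) t)"

definition f2 :: "real \<Rightarrow> real" where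
  "f2 t = f1 (- t)"

definition fmax :: "real \<Rightarrow> real" where
  "fmax t = max (f1 t) (f2 t)"

end

(* Write h for the left endpoint l_{k+1} of the k-th interval [h, 2h], whose midpoint is t_k = 3h/2.
   Subtracting -t^2, the conditions on p_k say that the remainder has zeros of order four at h and 2h,
   a zero at t_k, and slope (s_k - 1)(-2 t_k) = -12 h^3 there, so it is
   -3072 h^{-5} (t-h)^4 (t-2h)^4 (t-3h/2) = h^4 b(t/h) for one fixed C^3 bump b supported in [1,2].
   Hence f1 = -t^2 + sum_k h_k^4 b(t/h_k), and the j-th derivatives of the summands are O(h_k^{4-j}),
   so for j <= 3 the series may be differentiated termwise. As b' <= 64/9, the perturbation has slope
   at most (64/9) h^3 < 2t on [h, 2h], so f1 decreases on [0,1]; the even function f_max then decreases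
   in |t|. At t_k the two pieces of f_max cross with different slopes. *)
theory Submission
  imports Defs "HOL-Computational_Algebra.Field_as_Ring" "HOL-Computational_Algebra.Polynomial_Factorial"
begin

section \<open>The interpolation problem\<close>

text \<open>In characteristic 0, differentiation lowers the order of a root by exactly one, which
  drives the induction. This turns the derivative conditions on \<open>p_k\<close> into
  divisibility.\<close>

lemma linear_power_dvd_iff_pderivs:
  fixes p :: "'a :: field_char_0 poly"
  shows "[:-a, 1:] ^ n dvd p \<longleftrightarrow> (\<forall>j<n. poly ((pderiv ^^ j) p) a = 0)"
proof (induction n arbitrary: p)
  case 0
  then show ?case by simp
next
  case (Suc n)
  have "[:-a, 1:] ^ Suc n dvd p \<longleftrightarrow> poly p a = 0 \<and> [:-a, 1:] ^ n dvd pderiv p"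
  proof
    assume "[:-a, 1:] ^ Suc n dvd p"
    then obtain r where r: "p = [:-a, 1:] ^ Suc n * r" by (elim dvdE)
    have "pderiv p = [:-a, 1:] ^ n * ([:-a, 1:] * pderiv r + smult (of_nat (Suc n)) r)"
      unfolding r pderiv_mult pderiv_power_Suc
      by (simp add: pderiv_pCons algebra_simps smult_add_right)
    then show "poly p a = 0 \<and> [:-a, 1:] ^ n dvd pderiv p"
      using r by simp
  next
    assume *: "poly p a = 0 \<and> [:-a, 1:] ^ n dvd pderiv p"
    show "[:-a, 1:] ^ Suc n dvd p"
    \<comment> \<open>The zero polynomial has no meaningful root order, so constant \<open>p\<close>
      is treated apart; having a root, it is 0.\<close>
    proof (cases "pderiv p = 0")
      case True
      then obtain c where "p = [:c:]"
        using pderiv_eq_0_iff degree_eq_zeroE by blast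
      with * show ?thesis by simp
    next
      case False
      then have "p \<noteq> 0" by auto
      with * have "order a p = Suc (order a (pderiv p))"
        by (intro order_pderiv) auto
      moreover have "n \<le> order a (pderiv p)"
        using * False order_divides by blast
      ultimately show ?thesis
        using \<open>p \<noteq> 0\<close> order_divides[of a "Suc n" p] by simp
    qed
  qed
  also have "\<dots> \<longleftrightarrow> (\<forall>j<Suc n. poly ((pderiv ^^ j) p) a = 0)"
    by (auto simp: Suc.IH less_Suc_eq_0_disj funpow_Suc_right simp del: funpow.simps)
  finally show ?case .
qed

lemma higher_deriv_poly:
  fixes p :: "real poly"
  shows "(deriv ^^ j) (poly p) = poly ((pderiv ^^ j) p)"
proof (induction j)
  case (Suc j)
  have "deriv (poly q) = poly (pderiv q)" for q :: "real poly"
    by (rule ext) (simp add: DERIV_imp_deriv poly_DERIV)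
  with Suc show ?case by simp
qed simp

lemma higher_pderiv_diff:
  fixes p q :: "'a :: idom poly"
  shows "(pderiv ^^ j) (p - q) = (pderiv ^^ j) p - (pderiv ^^ j) q"
  by (induction j arbitrary: p q) (simp_all add: funpow_Suc_right pderiv_diff del: funpow.simps)

lemma l_seq_Suc: "l_seq k = 2 * l_seq (Suc k)"
  by (simp add: l_seq_def)

lemma l_seq_pos [simp]: "0 < l_seq k"
  by (simp add: l_seq_def)

lemma l_seq_le_1: "l_seq k \<le> 1"
  by (simp add: l_seq_def)

lemma t_seq_eq: "t_seq k = 3 / 2 * l_seq (Suc k)"
  by (simp add: t_seq_def l_seq_Suc[of k])

lemma s_seq_eq: "s_seq k = 1 + 4 * l_seq (Suc k) ^ 2"
  by (simp add: s_seq_def l_seq_def power_even_eq power_divide power_mult_distrib)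

text \<open>Subtracting \<open>[:0, 0, -1:]\<close>, the polynomial -t^2, makes all conditions but
  the slope homogeneous; agreement of derivatives 0 to 3 becomes a zero of order four.\<close>

lemma p_conditions_iff:
  "p_conditions k P \<longleftrightarrow> degree P \<le> 9 \<and>
     [:- l_seq (Suc k), 1:] ^ 4 dvd P - [:0, 0, -1:] \<and>
     [:- l_seq k, 1:] ^ 4 dvd P - [:0, 0, -1:] \<and>
     poly (P - [:0, 0, -1:]) (t_seq k) = 0 \<and>
     poly (pderiv (P - [:0, 0, -1:])) (t_seq k) = (s_seq k - 1) * (- 2 * t_seq k)"
proof -
  have sq: "(\<lambda>t. - t\<^sup>2) = poly [:0, 0, -1 :: real:]"
    by (auto simp: power2_eq_square)
  have "(\<forall>j\<le>3. (deriv ^^ j) (poly P) x = (deriv ^^ j) (\<lambda>t. - t\<^sup>2) x) \<longleftrightarrow>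
      [:- x, 1:] ^ 4 dvd P - [:0, 0, -1:]" for x
    unfolding sq linear_power_dvd_iff_pderivs higher_deriv_poly higher_pderiv_diff
    by (simp add: less_Suc_eq_le numeral_eq_Suc)
  moreover have "deriv (poly P) = poly (pderiv P)"
    using higher_deriv_poly[of 1 P] by simp
  ultimately show ?thesis
    by (auto simp: p_conditions_def pderiv_diff pderiv_pCons power2_eq_square algebra_simps)
qed

section \<open>Existence and uniqueness of the interpolant\<close>

text \<open>The two quartic factors multiply to h^8/256 at the midpoint 3h/2, and the slope wanted
  there is -12 h^3; the quotient is the constant -3072/h^5.\<close>

definition p_sol :: "nat \<Rightarrow> real poly" where
  "p_sol k = (let h = l_seq (Suc k) in
     [:0, 0, -1:] + smult (- 3072 / h ^ 5)
       ([:- h, 1:] ^ 4 * [:- (2 * h), 1:] ^ 4 * [:- (3 / 2 * h), 1:]))"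

lemma p_conditions_p_sol: "p_conditions k (p_sol k)"
proof -
  define h where "h = l_seq (Suc k)"
  have h: "h > 0" by (simp add: h_def)
  define A where "A = [:- h, 1:] ^ 4 * [:- (2 * h), 1:] ^ 4"
  define Q where "Q = smult (- 3072 / h ^ 5) (A * [:- (3 / 2 * h), 1:])"
  have p: "p_sol k = [:0, 0, -1:] + Q"
    by (simp add: p_sol_def Let_def h_def A_def Q_def)
  have "degree A = 8"
    by (simp add: A_def degree_mult_eq degree_linear_power)
  then have "degree (A * [:- (3 / 2 * h), 1:]) \<le> 9"
    using degree_mult_le[of A "[:- (3 / 2 * h), 1:]"] by simp
  then have "degree Q \<le> 9"
    unfolding Q_def using degree_smult_le order_trans by blast
  then have "degree (p_sol k) \<le> 9"
    unfolding p by (intro degree_add_le) auto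
  moreover have "[:- h, 1:] ^ 4 dvd Q" "[:- (2 * h), 1:] ^ 4 dvd Q"
    unfolding Q_def A_def mult.assoc
    by (simp_all only: dvd_smult dvd_mult dvd_triv_left)
  moreover have "poly Q (3 / 2 * h) = 0"
    by (simp add: Q_def)
  moreover have "poly (pderiv Q) (3 / 2 * h) = 4 * h ^ 2 * (- 2 * (3 / 2 * h))"
  proof -
    \<comment> \<open>Of the product rule only the term with \<open>A\<close> survives, since the
      linear factor vanishes at the midpoint.\<close>
    have "poly (pderiv Q) (3 / 2 * h) = - 3072 / h ^ 5 * poly A (3 / 2 * h)"
      unfolding Q_def pderiv_smult pderiv_mult by (simp add: pderiv_pCons)
    also have "poly A (3 / 2 * h) = (3 / 2 * h - h) ^ 4 * (3 / 2 * h - 2 * h) ^ 4"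
      by (simp add: A_def)
    also have "3 / 2 * h - h = h / 2" by simp
    also have "3 / 2 * h - 2 * h = - (h / 2)" by simp
    also have "(h / 2) ^ 4 * (- (h / 2)) ^ 4 = h ^ 5 * h ^ 3 / 256"
      by (simp add: power_divide)
    also have "- 3072 / h ^ 5 * (h ^ 5 * h ^ 3 / 256) = 4 * h ^ 2 * (- 2 * (3 / 2 * h))"
      using h by (simp add: power2_eq_square power3_eq_cube)
    finally show ?thesis .
  qed
  moreover have "l_seq k = 2 * h" "t_seq k = 3 / 2 * h" "s_seq k - 1 = 4 * h ^ 2"
    by (simp_all add: h_def l_seq_Suc[of k] t_seq_eq s_seq_eq)
  moreover have "p_sol k - [:0, 0, -1:] = Q"
    by (simp only: p add_diff_cancel_left')
  ultimately show ?thesis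
    by (simp only: p_conditions_iff simp_thms flip: h_def)
qed

text \<open>A common divisor divides the difference, the nonzero constant b - a.\<close>

lemma coprime_linear_polys:
  fixes a b :: "'a :: field_gcd"
  assumes "a \<noteq> b"
  shows "coprime [:- a, 1:] [:- b, 1:]"
proof (rule coprimeI)
  fix c assume "c dvd [:- a, 1:]" "c dvd [:- b, 1:]"
  then have "c dvd [:- a, 1:] - [:- b, 1:]" by (rule dvd_diff)
  moreover have "is_unit ([:- a, 1:] - [:- b, 1:])"
    using assms by (simp add: is_unit_pCons_iff)
  ultimately show "is_unit c" by (rule dvd_unit_imp_unit)
qed

text \<open>The difference of two solutions has zeros of orders 4, 4 and 2 at three distinct points,
  ten in all, but degree at most nine.\<close>

lemma p_conditions_unique:
  assumes "p_conditions k P" "p_conditions k P'"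
  shows "P = P'"
proof (rule ccontr)
  assume "P \<noteq> P'"
  define D where "D = P - P'"
  have D: "D = (P - [:0, 0, -1:]) - (P' - [:0, 0, -1:])" by (simp add: D_def)
  let ?a = "l_seq (Suc k)" and ?b = "l_seq k" and ?m = "t_seq k"
  have "\<forall>j<2. poly ((pderiv ^^ j) D) ?m = 0"
    using assms unfolding D p_conditions_iff
    by (auto simp: less_2_cases_iff pderiv_diff)
  then have "[:- ?m, 1:] ^ 2 dvd D"
    by (simp add: linear_power_dvd_iff_pderivs)
  moreover have "[:- ?a, 1:] ^ 4 dvd D" "[:- ?b, 1:] ^ 4 dvd D"
    unfolding D using assms by (simp_all only: p_conditions_iff dvd_diff)
  moreover have "?a \<noteq> ?b" "?a \<noteq> ?m" "?b \<noteq> ?m"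
    using l_seq_pos[of "Suc k"] by (simp_all add: t_seq_eq l_seq_Suc[of k] del: l_seq_pos)
  then have "coprime [:- ?a, 1:] [:- ?b, 1:]" "coprime [:- ?a, 1:] [:- ?m, 1:]"
    "coprime [:- ?b, 1:] [:- ?m, 1:]"
    by (simp_all only: coprime_linear_polys not_False_eq_True)
  ultimately have "[:- ?a, 1:] ^ 4 * [:- ?b, 1:] ^ 4 * [:- ?m, 1:] ^ 2 dvd D"
    by (intro divides_mult) auto
  moreover have "D \<noteq> 0" using \<open>P \<noteq> P'\<close> by (simp add: D_def)
  ultimately have "degree ([:- ?a, 1:] ^ 4 * [:- ?b, 1:] ^ 4 * [:- ?m, 1:] ^ 2) \<le> degree D"
    by (rule dvd_imp_degree_le)
  moreover have "degree ([:- ?a, 1:] ^ 4 * [:- ?b, 1:] ^ 4 * [:- ?m, 1:] ^ 2) = 10"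
    by (simp add: degree_mult_eq degree_linear_power)
  moreover have "degree D \<le> 9"
    using assms unfolding D_def p_conditions_def by (auto intro: degree_diff_le)
  ultimately show False by simp
qed

lemma p_poly_eq: "p_poly k = p_sol k"
  unfolding p_poly_def using p_conditions_p_sol p_conditions_unique by blast

section \<open>Bumps\<close>

text \<open>An exponent of at least 2 smooths the corner: at 0 the difference quotient is still a
  positive power of \<open>max 0 y\<close> and tends to 0. Elsewhere the function is locally 0 or a
  monomial.\<close>

lemma DERIV_max_0_power:
  assumes f: "(f has_real_derivative f') (at x)"
  shows "((\<lambda>x. max 0 (f x) ^ Suc (Suc n)) has_real_derivative
           real (Suc (Suc n)) * max 0 (f x) ^ Suc n * f') (at x)"
proof -
  have "((\<lambda>y :: real. max 0 y ^ Suc (Suc n)) has_real_derivative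
           real (Suc (Suc n)) * max 0 z ^ Suc n) (at z)" for z
  proof (cases "z = 0")
    case True
    have "(\<lambda>y :: real. max 0 y ^ Suc (Suc n) / y) \<midarrow>0\<rightarrow> 0"
    proof (rule Lim_transform_eventually)
      have "(\<lambda>y :: real. max 0 y ^ Suc n) \<midarrow>0\<rightarrow> max 0 0 ^ Suc n"
        by (intro tendsto_intros)
      then show "(\<lambda>y :: real. max 0 y ^ Suc n) \<midarrow>0\<rightarrow> 0" by simp
      show "\<forall>\<^sub>F y in at 0. max 0 y ^ Suc n = (max 0 y ^ Suc (Suc n) / y :: real)"
        by (auto simp: eventually_at_filter max_def)
    qed
    then show ?thesis
      unfolding True has_field_derivative_iff by simp
  next
    case False
    then consider "z < 0" | "z > 0" by linarith
    then show ?thesis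
    proof cases
      case 1
      have "((\<lambda>_ :: real. 0) has_real_derivative 0) (at z)" by simp
      then have "((\<lambda>y :: real. max 0 y ^ Suc (Suc n)) has_real_derivative 0) (at z)"
        by (rule has_field_derivative_transform_within_open[of _ _ _ "{..<0}"])
           (use 1 in auto)
      then show ?thesis using 1 by simp
    next
      case 2
      have "((\<lambda>y. y ^ Suc (Suc n)) has_real_derivative real (Suc (Suc n)) * z ^ Suc n) (at z)"
        using DERIV_pow[of "Suc (Suc n)" z UNIV] by simp
      then have "((\<lambda>y. max 0 y ^ Suc (Suc n)) has_real_derivative
          real (Suc (Suc n)) * z ^ Suc n) (at z)"
        by (rule has_field_derivative_transform_within_open[of _ _ _ "{0<..}"])
           (use 2 in auto)
      then show ?thesis using 2 by simp
    qed
  qed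
  from DERIV_chain2[OF this f] show ?thesis by (simp add: mult_ac)
qed

text \<open>
  With \<open>w = (u - 1) * (2 - u)\<close>, the function \<open>bump 0\<close> is the remainder rescaled to \<open>[1, 2]\<close>,
  and \<open>bump j\<close> is its \<open>j\<close>-th derivative for \<open>j \<le> 3\<close>, expanded using \<open>w' = 3 - 2 * u\<close> and \<open>w'' = -2\<close>.
  The values for \<open>j > 3\<close> are junk.
\<close>
definition wedge :: "real \<Rightarrow> real" where
  "wedge u = max 0 ((u - 1) * (2 - u))"

fun bump :: "nat \<Rightarrow> real \<Rightarrow> real" where
  "bump 0 u = 1536 * wedge u ^ 4 * (3 - 2 * u)"
| "bump (Suc 0) u = 1536 * (4 * wedge u ^ 3 * (3 - 2 * u) ^ 2 - 2 * wedge u ^ 4)"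
| "bump (Suc (Suc 0)) u = 1536 * (12 * wedge u ^ 2 * (3 - 2 * u) ^ 3 - 24 * wedge u ^ 3 * (3 - 2 * u))"
| "bump (Suc (Suc (Suc _))) u = 1536 * (24 * wedge u * (3 - 2 * u) ^ 4
     - 144 * wedge u ^ 2 * (3 - 2 * u) ^ 2 + 48 * wedge u ^ 3)"

lemma wedge_eq_0: "u \<le> 1 \<or> 2 \<le> u \<Longrightarrow> wedge u = 0"
  by (auto simp: wedge_def max_def mult_le_0_iff zero_le_mult_iff)

lemma bump_eq_0: "u \<le> 1 \<or> 2 \<le> u \<Longrightarrow> bump j u = 0"
  by (cases "(j, u)" rule: bump.cases) (auto dest!: wedge_eq_0)

text \<open>For j < 3 every \<open>wedge\<close> in \<open>bump j\<close> has exponent at least 2,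
  so its corners do no harm. In \<open>bump 3\<close> a bare \<open>wedge\<close> appears, which is
  only continuous.\<close>

lemma DERIV_bump:
  assumes "j < 3"
  shows "(bump j has_real_derivative bump (Suc j) u) (at u)"
proof -
  have "((\<lambda>u. wedge u ^ Suc (Suc n)) has_real_derivative
      real (Suc (Suc n)) * wedge u ^ Suc n * (3 - 2 * u)) (at u)" for n
    unfolding wedge_def
    by (rule DERIV_max_0_power) (auto intro!: derivative_eq_intros)
  from this[of 0] this[of 1] this[of 2]
  have [derivative_intros]:
    "((\<lambda>u. wedge u ^ 2) has_real_derivative 2 * wedge u * (3 - 2 * u)) (at u)"
    "((\<lambda>u. wedge u ^ 3) has_real_derivative 3 * wedge u ^ 2 * (3 - 2 * u)) (at u)"
    "((\<lambda>u. wedge u ^ 4) has_real_derivative 4 * wedge u ^ 3 * (3 - 2 * u)) (at u)"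
    by (simp_all add: numeral_eq_Suc)
  from assms consider "j = 0" | "j = Suc 0" | "j = Suc (Suc 0)" by linarith
  then show ?thesis
  proof cases
    case 1
    show ?thesis unfolding 1 bump.simps
      by (rule derivative_eq_intros refl)+ (simp add: algebra_simps power2_eq_square)
  next
    case 2
    show ?thesis unfolding 2 bump.simps
      by (rule derivative_eq_intros refl)+ (simp add: algebra_simps numeral_eq_Suc)
  next
    case 3
    show ?thesis unfolding 3 bump.simps
      by (rule derivative_eq_intros refl)+ (simp add: algebra_simps numeral_eq_Suc)
  qed
qed

lemma continuous_on_bump: "continuous_on A (bump j)"
proof -
  have [continuous_intros]: "continuous_on A wedge"
    unfolding wedge_def by (intro continuous_intros)
  show ?thesis
    by (cases "(j, 0 :: real)" rule: bump.cases) (auto intro!: continuous_intros)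
qed

lemma bump_bounded: "\<exists>M. \<forall>u. \<bar>bump j u\<bar> \<le> M"
proof -
  have "compact (bump j ` {1..2})"
    by (intro compact_continuous_image continuous_on_bump) auto
  then obtain M where M: "\<And>u. u \<in> {1..2} \<Longrightarrow> \<bar>bump j u\<bar> \<le> M"
    by (meson bounded_real compact_imp_bounded imageI)
  have "\<bar>bump j u\<bar> \<le> M" for u
    \<comment> \<open>The instance at 1 gives M \<ge> 0, which is the bound needed outside
      [1,2].\<close>
    using M[of u] M[of 1] bump_eq_0[of u j] by (cases "u \<in> {1..2}") auto
  then show ?thesis by blast
qed

text \<open>As (3 - 2u)^2 = 1 - 4w, the slope is a polynomial in w alone, with maximum 64/9 at w =
  1/6.\<close>

lemma bump_1_le: "bump 1 u \<le> 64 / 9"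
proof (cases "u \<le> 1 \<or> 2 \<le> u")
  case True
  then show ?thesis by (simp only: bump_eq_0)
next
  case False
  define w where "w = (u - 1) * (2 - u)"
  have w: "wedge u = w" "w \<ge> 0"
    using False by (auto simp: wedge_def w_def)
  have *: "(3 - 2 * u) ^ 2 = 1 - 4 * w"
    by (simp add: w_def power2_eq_square algebra_simps)
  have "bump 1 u = 1536 * (4 * w ^ 3 * (1 - 4 * w) - 2 * w ^ 4)"
    by (simp only: One_nat_def bump.simps w(1) *)
  also have "\<dots> = 3072 * (2 * w ^ 3 - 9 * w ^ 4)"
    by (simp add: algebra_simps numeral_eq_Suc)
  finally have "bump 1 u = 3072 * (2 * w ^ 3 - 9 * w ^ 4)" .
  \<comment> \<open>The maximum at 1/6 is a double root of the gap; the remaining quadratic is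
    positive for w \<ge> 0.\<close>
  moreover have "64 / 9 - 3072 * (2 * w ^ 3 - 9 * w ^ 4)
      = 27648 * ((w - 1 / 6) ^ 2 * (w ^ 2 + w / 9 + 1 / 108))"
    by (simp add: field_simps numeral_eq_Suc)
  moreover have "(w - 1 / 6) ^ 2 * (w ^ 2 + w / 9 + 1 / 108) \<ge> 0"
    using w by simp
  ultimately show ?thesis by linarith
qed

section \<open>The perturbation of the parabola\<close>

text \<open>For j \<le> 3 this is the formal j-th derivative of the perturbation: each
  differentiation of h^4 b(t/h) costs one factor h.\<close>

definition osc :: "nat \<Rightarrow> real \<Rightarrow> real" where
  "osc j t = (\<Sum>k. l_seq (Suc k) ^ (4 - j) * bump j (t / l_seq (Suc k)))"

text \<open>For j < 4 at least one factor h \<le> 1 remains, so a geometric series majorizes the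
  terms.\<close>

lemma uniformly_convergent_osc:
  assumes "j < 4"
  shows "uniformly_convergent_on UNIV
           (\<lambda>n t. \<Sum>k<n. l_seq (Suc k) ^ (4 - j) * bump j (t / l_seq (Suc k)))"
proof -
  obtain M where M: "\<And>u. \<bar>bump j u\<bar> \<le> M" using bump_bounded[of j] by blast
  show ?thesis
  proof (rule Weierstrass_m_test'[where M = "\<lambda>k. l_seq (Suc k) * M"])
    fix k t
    have "\<bar>l_seq (Suc k) ^ (4 - j)\<bar> \<le> l_seq (Suc k)"
      using assms power_decreasing[of 1 "4 - j" "l_seq (Suc k)"] l_seq_le_1[of "Suc k"]
        l_seq_pos[of "Suc k"] by (simp del: l_seq_pos)
    then show "norm (l_seq (Suc k) ^ (4 - j) * bump j (t / l_seq (Suc k))) \<le> l_seq (Suc k) * M"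
      using M by (auto simp: abs_mult less_imp_le intro!: mult_mono)
    have "summable (\<lambda>k. (1 / 2) ^ Suc k * M)"
      by (intro summable_mult2) (simp add: summable_geometric summable_mult)
    then show "summable (\<lambda>k. l_seq (Suc k) * M)"
      by (simp add: l_seq_def power_divide)
  qed
qed

lemma DERIV_osc:
  assumes "j < 3"
  shows "(osc j has_real_derivative osc (Suc j) t) (at t)"
  unfolding osc_def
\<comment> \<open>Termwise differentiation needs convergence of the original series at one point; at
  0 all terms vanish.\<close>
proof (rule has_field_derivative_series'(2)[where S = UNIV and ?x0.0 = 0])
  fix k t
  define h where "h = l_seq (Suc k)"
  have "h > 0" by (simp add: h_def)
  have "((\<lambda>t. h ^ (4 - j) * bump j (t / h)) has_real_derivative
      h ^ (4 - j) * (bump (Suc j) (t / h) * (1 / h))) (at t)"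
    by (intro DERIV_cmult DERIV_chain2[OF DERIV_bump[OF assms]] DERIV_cdivide DERIV_ident)
  also have "h ^ (4 - j) * (bump (Suc j) (t / h) * (1 / h)) = h ^ (4 - Suc j) * bump (Suc j) (t / h)"
  proof -
    obtain n where "4 - j = Suc n" "4 - Suc j = n"
      using assms by (intro that[of "4 - Suc j"]) auto
    then show ?thesis using \<open>h > 0\<close> by simp
  qed
  finally show "((\<lambda>t. h ^ (4 - j) * bump j (t / h)) has_real_derivative
      h ^ (4 - Suc j) * bump (Suc j) (t / h)) (at t)" .
next
  show "uniformly_convergent_on UNIV
      (\<lambda>n t. \<Sum>k<n. l_seq (Suc k) ^ (4 - Suc j) * bump (Suc j) (t / l_seq (Suc k)))"
    using assms by (intro uniformly_convergent_osc) simp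
qed (simp_all add: bump_eq_0)

lemma continuous_on_osc_3: "continuous_on A (osc 3)"
  unfolding osc_def
proof (rule uniform_limit_theorem)
  show "uniform_limit A (\<lambda>n t. \<Sum>k<n. l_seq (Suc k) ^ (4 - 3) * bump 3 (t / l_seq (Suc k)))
      (\<lambda>t. \<Sum>k. l_seq (Suc k) ^ (4 - 3) * bump 3 (t / l_seq (Suc k))) sequentially"
    by (rule uniform_limit_suminf, rule uniformly_convergent_on_subset,
        rule uniformly_convergent_osc) auto
  show "\<forall>\<^sub>F n in sequentially.
      continuous_on A (\<lambda>t. \<Sum>k<n. l_seq (Suc k) ^ (4 - 3) * bump 3 (t / l_seq (Suc k)))"
    by (intro always_eventually allI continuous_intros
        continuous_on_compose2[OF continuous_on_bump[of UNIV]]) (auto simp: less_imp_neq[symmetric])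
qed auto

lemma osc_nonpos: "t \<le> 0 \<Longrightarrow> osc j t = 0"
  by (simp add: osc_def bump_eq_0 divide_nonpos_pos order_trans[of _ 0 1])

section \<open>The series on a single dyadic interval\<close>

lemma l_seq_antimono: "i \<le> k \<Longrightarrow> l_seq k \<le> l_seq i"
  by (simp add: l_seq_def field_simps)

text \<open>The i-th term is supported in [l_{i+1}, l_i]. These intervals meet at most in endpoints,
  where every bump vanishes, so the closed interval is allowed.\<close>

lemma osc_eq:
  assumes t: "t \<in> {l_seq (Suc k)..l_seq k}"
  shows "osc j t = l_seq (Suc k) ^ (4 - j) * bump j (t / l_seq (Suc k))"
proof -
  have "bump j (t / l_seq (Suc i)) = 0" if "i \<noteq> k" for i
  proof (rule bump_eq_0)
    from that consider "i < k" | "k < i" by linarith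
    then show "t / l_seq (Suc i) \<le> 1 \<or> 2 \<le> t / l_seq (Suc i)"
    proof cases
      case 1
      then have "l_seq k \<le> l_seq (Suc i)" by (intro l_seq_antimono) auto
      with t show ?thesis by (simp add: divide_le_eq)
    next
      case 2
      then have "l_seq i \<le> l_seq (Suc k)" by (intro l_seq_antimono) auto
      with t show ?thesis by (simp add: le_divide_eq l_seq_Suc[of i])
    qed
  qed
  then show ?thesis
    unfolding osc_def by (subst suminf_finite[of "{k}"]) auto
qed

lemma l_seq_interval_exists:
  assumes "0 < t" "t \<le> 1"
  obtains k where "t \<in> {l_seq (Suc k)..l_seq k}"
proof -
  define n where "n = (LEAST n. l_seq n \<le> t)"
  obtain m where "(1 / 2) ^ m < t"
    using real_arch_pow_inv[of t "1 / 2"] assms by auto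
  then have "l_seq m \<le> t" by (simp add: l_seq_def power_divide)
  then have n: "l_seq n \<le> t" unfolding n_def by (rule LeastI)
  show ?thesis
  proof (cases n)
    \<comment> \<open>Here t = 1, the right endpoint of the interval with index 0.\<close>
    case 0
    then show ?thesis using n assms that[of 0] by (simp add: l_seq_def)
  next
    case (Suc k)
    then have "\<not> l_seq k \<le> t" using not_less_Least[of k "\<lambda>n. l_seq n \<le> t"] n_def by simp
    then show ?thesis using n Suc that[of k] by simp
  qed
qed

text \<open>With t = h u the nine linear factors yield h^9, of which h^4 survives division by h^5.
  The sign of 2 - u is lost in the even power, and on [1,2] \<open>wedge\<close> is not
  truncated.\<close>

lemma poly_p_sol:
  assumes t: "t \<in> {l_seq (Suc k)..l_seq k}"
  shows "poly (p_sol k) t = - t\<^sup>2 + osc 0 t"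
proof -
  define h where "h = l_seq (Suc k)"
  have h: "h > 0" by (simp add: h_def)
  define u where "u = t / h"
  have tu: "t = h * u" using h by (simp add: u_def)
  have u: "1 \<le> u" "u \<le> 2"
    using t h by (auto simp: u_def field_simps l_seq_Suc[of k] simp flip: h_def)
  define W where "W = ((u - 1) * (2 - u)) ^ 4"
  have "(t - h) ^ 4 * (t - 2 * h) ^ 4 * (t - 3 / 2 * h) = h ^ 5 * (h ^ 4 * (W * (u - 3 / 2)))"
  proof -
    have "t - h = h * (u - 1)" "t - 2 * h = h * - (2 - u)" "t - 3 / 2 * h = h * (u - 3 / 2)"
      by (simp_all add: tu algebra_simps)
    moreover have "h ^ 4 * a * (h ^ 4 * b) * (h * c) = h ^ 5 * (h ^ 4 * (a * b * c))" for a b c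
      by (simp add: numeral_eq_Suc mult_ac)
    ultimately show ?thesis
      by (simp only: W_def power_mult_distrib power_minus_even even_numeral)
  qed
  moreover have "poly (p_sol k) t =
      - t\<^sup>2 + - 3072 / h ^ 5 * ((t - h) ^ 4 * (t - 2 * h) ^ 4 * (t - 3 / 2 * h))"
    unfolding p_sol_def Let_def h_def[symmetric] poly_add poly_smult poly_mult poly_power
    by (simp add: power2_eq_square)
  ultimately have "poly (p_sol k) t = - t\<^sup>2 + - 3072 / h ^ 5 * (h ^ 5 * (h ^ 4 * (W * (u - 3 / 2))))"
    by simp
  also have "- 3072 / h ^ 5 * (h ^ 5 * (h ^ 4 * (W * (u - 3 / 2)))) = - 3072 * (h ^ 4 * (W * (u - 3 / 2)))"
  proof -
    have "- 3072 / H * (H * X) = - 3072 * X" if "H \<noteq> 0" for H X :: real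
      using that by simp
    then show ?thesis using h by (metis less_irrefl zero_less_power)
  qed
  also have "\<dots> = h ^ 4 * (1536 * W * (3 - 2 * u))"
    by (simp add: algebra_simps)
  also have "\<dots> = osc 0 t"
    using u by (simp add: osc_eq[OF t] wedge_def W_def flip: h_def u_def)
  finally show ?thesis .
qed

text \<open>The index picked by \<open>SOME\<close> is immaterial: every admissible one gives the
  same value, because the right-hand side of \<open>poly_p_sol\<close> is free of k.\<close>

lemma f1_eq:
  assumes "t \<le> 1"
  shows "f1 t = - t\<^sup>2 + osc 0 t"
proof (cases "t \<le> 0")
  case True
  then show ?thesis by (simp add: f1_def osc_nonpos)
next
  case False
  then have "\<exists>k. t \<in> {l_seq (k + 1)..l_seq k}"
    using l_seq_interval_exists[of t] assms by (metis Suc_eq_plus1 not_le)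
  then have "t \<in> {l_seq ((SOME k. t \<in> {l_seq (k + 1)..l_seq k}) + 1)..
      l_seq (SOME k. t \<in> {l_seq (k + 1)..l_seq k})}"
    by (rule someI_ex)
  then show ?thesis
    using False by (simp add: f1_def p_poly_eq poly_p_sol)
qed

lemma f1_eq_p_poly:
  assumes "t \<in> {l_seq (k + 1)..l_seq k}"
  shows "f1 t = poly (p_poly k) t"
proof -
  have "t \<le> 1" using assms l_seq_le_1[of k] by auto
  then show ?thesis
    using assms by (simp add: f1_eq p_poly_eq poly_p_sol)
qed

section \<open>Properties of the two pieces and their maximum\<close>

text \<open>Serves \<open>f2\<close>: by the chain rule the j-th derivative of D 0 (-t) carries the
  sign (-1)^j.\<close>

lemma Cq_on_reflect:
  assumes D: "\<And>j t. j < q \<Longrightarrow> (D j has_real_derivative D (Suc j) t) (at t)"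
    and "continuous_on UNIV (D q)" and f: "\<And>t. t \<in> S \<Longrightarrow> D 0 (- t) = f t"
  shows "Cq_on q f S"
  unfolding Cq_on_def
proof (intro exI[of _ "\<lambda>j t. (- 1) ^ j * D j (- t)"] conjI allI ballI impI)
  fix j t assume "j < q"
  have "((\<lambda>t. D j (- t)) has_real_derivative - D (Suc j) (- t)) (at t)"
    using D[OF \<open>j < q\<close>, of "- t"] by (simp add: DERIV_mirror)
  then show "((\<lambda>t. (- 1) ^ j * D j (- t)) has_real_derivative (- 1) ^ Suc j * D (Suc j) (- t))
      (at t within S)"
    by (auto intro!: derivative_eq_intros intro: has_field_derivative_at_within)
next
  show "continuous_on S (\<lambda>t. (- 1) ^ q * D q (- t))"
    by (intro continuous_intros continuous_on_compose2[OF assms(2)]) auto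
qed (simp add: f)

lemma Cq_onI:
  assumes "\<And>j t. j < q \<Longrightarrow> (D j has_real_derivative D (Suc j) t) (at t)"
    and "continuous_on UNIV (D q)" and "\<And>t. t \<in> S \<Longrightarrow> D 0 t = f t"
  shows "Cq_on q f S"
  unfolding Cq_on_def using assms
  by (intro exI[of _ D]) (auto intro: has_field_derivative_at_within continuous_on_subset)

text \<open>A smooth extension of \<open>f1\<close> past 1, where \<open>f1\<close> itself is
  uncontrolled; the one-sided derivatives at 1 are restrictions of two-sided ones.\<close>

definition f1_deriv :: "nat \<Rightarrow> real \<Rightarrow> real" where
  "f1_deriv j t = poly ((pderiv ^^ j) [:0, 0, -1:]) t + osc j t"

lemma f1_deriv_0: "t \<le> 1 \<Longrightarrow> f1_deriv 0 t = f1 t"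
  by (simp add: f1_deriv_def f1_eq power2_eq_square)

lemma f1_deriv_1: "f1_deriv 1 t = - 2 * t + osc 1 t"
  by (simp add: f1_deriv_def pderiv_pCons)

lemma DERIV_f1_deriv: "j < 3 \<Longrightarrow> (f1_deriv j has_real_derivative f1_deriv (Suc j) t) (at t)"
  unfolding f1_deriv_def by (auto intro!: DERIV_add poly_DERIV DERIV_osc)

lemma continuous_on_f1_deriv_3: "continuous_on A (f1_deriv 3)"
  unfolding f1_deriv_def by (intro continuous_intros continuous_on_osc_3)

lemma DERIV_f1:
  assumes "t < 1"
  shows "(f1 has_real_derivative - 2 * t + osc 1 t) (at t)"
proof -
  have "(f1_deriv 0 has_real_derivative - 2 * t + osc 1 t) (at t)"
    using DERIV_f1_deriv[of 0 t] f1_deriv_1[of t] by simp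
  then show ?thesis
    by (rule has_field_derivative_transform_within_open[of _ _ _ "{..<1}"])
       (use assms f1_deriv_0 in auto)
qed

section \<open>Monotonicity and the isolated maximum\<close>

lemma osc_1_less:
  assumes "0 < t" "t \<le> 1"
  shows "osc 1 t < 2 * t"
proof -
  obtain k where k: "t \<in> {l_seq (Suc k)..l_seq k}"
    using l_seq_interval_exists assms by blast
  define h where "h = l_seq (Suc k)"
  have h: "0 < h" "h \<le> 1 / 2"
    using l_seq_le_1[of k] by (simp_all add: h_def l_seq_Suc[of k])
  have "osc 1 t = h ^ 3 * bump 1 (t / h)"
    unfolding h_def osc_eq[OF k] by simp
  also have "\<dots> \<le> h ^ 3 * (64 / 9)"
    using h by (intro mult_left_mono bump_1_le) auto
  also have "\<dots> \<le> h * (1 / 4) * (64 / 9)"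
  proof -
    have "h * h \<le> 1 / 2 * (1 / 2)" using h by (intro mult_mono) auto
    then have "h * (h * h) \<le> h * (1 / 4)" using h by (intro mult_left_mono) auto
    then show ?thesis by (simp add: power3_eq_cube)
  qed
  \<comment> \<open>The bound so far is (16/9) h, below 2h and hence below 2t.\<close>
  also have "\<dots> < 2 * t"
  proof -
    have "h \<le> t" using k by (simp add: h_def)
    with h show ?thesis by simp
  qed
  finally show ?thesis by simp
qed

lemma f1_strict_decreasing:
  assumes "0 \<le> s" "s < t" "t \<le> 1"
  shows "f1 t < f1 s"
proof -
  have "f1_deriv 0 t < f1_deriv 0 s"
  \<comment> \<open>The open-interval criterion is used because the derivative vanishes at 0, a
    possible value of s.\<close>
  proof (rule DERIV_neg_imp_decreasing_open[OF \<open>s < t\<close>])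
    fix x assume "s < x" "x < t"
    then have "f1_deriv 1 x < 0"
      unfolding f1_deriv_1 using osc_1_less[of x] assms by simp
    then show "\<exists>y. (f1_deriv 0 has_real_derivative y) (at x) \<and> y < 0"
      using DERIV_f1_deriv[of 0 x] by (intro exI[of _ "f1_deriv 1 x"]) simp
  next
    show "continuous_on {s..t} (f1_deriv 0)"
      by (rule DERIV_continuous_on, rule has_field_derivative_at_within, rule DERIV_f1_deriv) simp
  qed
  then show ?thesis using assms by (simp add: f1_deriv_0)
qed

lemma f2_nonneg: "0 \<le> t \<Longrightarrow> f2 t = - t\<^sup>2"
  by (simp add: f2_def f1_def)

lemma fmax_even: "fmax \<bar>t\<bar> = fmax t"
  by (cases "t \<ge> 0") (simp_all only: fmax_def f2_def abs_of_nonneg abs_of_neg not_le minus_minus max.commute[of "f1 (- t)"])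

text \<open>Evenness reduces the claim to nonnegative arguments; there \<open>f1\<close> and
  \<open>f2\<close> both strictly decrease, hence so does their maximum.\<close>

lemma fmax_strict_decreasing:
  assumes "\<bar>s\<bar> < \<bar>t\<bar>" "\<bar>t\<bar> \<le> 1"
  shows "fmax t < fmax s"
proof -
  have "fmax \<bar>t\<bar> < fmax \<bar>s\<bar>"
  proof -
    have "f1 \<bar>t\<bar> < f1 \<bar>s\<bar>"
      using assms by (intro f1_strict_decreasing) auto
    moreover have "\<bar>s\<bar> ^ 2 < \<bar>t\<bar> ^ 2"
      using assms by (intro power_strict_mono) auto
    then have "f2 \<bar>t\<bar> < f2 \<bar>s\<bar>" by (simp only: f2_nonneg abs_ge_zero neg_less_iff_less)
    ultimately show ?thesis unfolding fmax_def by (simp add: max_def)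
  qed
  then show ?thesis unfolding fmax_even .
qed

lemma fmax_le_fmax_0:
  assumes "t \<in> {-1..1}"
  shows "fmax t \<le> fmax 0"
  using fmax_strict_decreasing[of 0 t] assms by (cases "t = 0") (auto simp: abs_le_iff)

text \<open>Moving a nonzero y slightly towards 0 increases \<open>fmax\<close>, so 0 is the only
  local maximizer and the whole line serves as isolating neighborhood.\<close>

lemma isolated_local_maximizer_fmax: "isolated_local_maximizer_on fmax {-1..1} 0"
proof -
  have "y = 0" if "local_maximizer_on fmax {-1..1} y" for y
  proof (rule ccontr)
    assume "y \<noteq> 0"
    obtain U where U: "open U" "y \<in> U" "y \<in> {-1..1}"
      "\<And>z. z \<in> U \<inter> {-1..1} \<Longrightarrow> fmax z \<le> fmax y"
      using \<open>local_maximizer_on fmax {-1..1} y\<close> unfolding local_maximizer_on_def by blast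
    \<comment> \<open>As c tends to 1 from below, c y enters every neighborhood of y; such a c gives
      the better point.\<close>
    have "((\<lambda>c. c * y) \<longlongrightarrow> 1 * y) (at_left 1)"
      by (intro tendsto_intros)
    then have "\<forall>\<^sub>F c in at_left 1. c * y \<in> U"
      using U by (intro topological_tendstoD) auto
    moreover have "\<forall>\<^sub>F c in at_left (1 :: real). c \<in> {0<..<1}"
      by (rule eventually_at_left_real) simp
    ultimately have "\<forall>\<^sub>F c in at_left 1. c * y \<in> U \<and> c \<in> {0<..<1}"
      by (rule eventually_conj)
    then obtain c where c: "c * y \<in> U" "0 < c" "c < 1"
      using eventually_happens'[OF trivial_limit_at_left_real] by fastforce
    have less: "\<bar>c * y\<bar> < \<bar>y\<bar>"
      using c \<open>y \<noteq> 0\<close> by (simp add: abs_mult)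
    moreover have "\<bar>y\<bar> \<le> 1" using U by auto
    ultimately have "fmax y < fmax (c * y)"
      by (rule fmax_strict_decreasing)
    moreover have "c * y \<in> {-1..1}" using less U by auto
    ultimately show False using U(4) c by fastforce
  qed
  then show ?thesis
    unfolding isolated_local_maximizer_on_def local_maximizer_on_def
    using fmax_le_fmax_0 by (auto intro!: exI[of _ UNIV])
qed

section \<open>Differentiability of the maximum at 0 and its failure at \<open>t_k\<close>\<close>

text \<open>Write the maximum as (f + g + |f - g|)/2. Since f - g has value and derivative 0 at x,
  so has |f - g|.\<close>

lemma DERIV_max_of_equal:
  fixes f g :: "real \<Rightarrow> real"
  assumes "(f has_real_derivative c) (at x)" "(g has_real_derivative c) (at x)" "f x = g x"
  shows "((\<lambda>y. max (f y) (g y)) has_real_derivative c) (at x)"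
proof -
  have "((\<lambda>y. f y - g y) has_real_derivative 0) (at x)"
    using DERIV_diff[OF assms(1,2)] by simp
  then have "(\<lambda>y. (f y - g y) / (y - x)) \<midarrow>x\<rightarrow> 0"
    using assms(3) by (simp add: has_field_derivative_iff)
  then have "(\<lambda>y. \<bar>f y - g y\<bar> / (y - x)) \<midarrow>x\<rightarrow> 0"
    by (rule tendsto_0_le[where K = 1]) (simp add: abs_divide)
  then have "((\<lambda>y. \<bar>f y - g y\<bar>) has_real_derivative 0) (at x)"
    using assms(3) by (simp add: has_field_derivative_iff)
  then have "((\<lambda>y. (f y + g y + \<bar>f y - g y\<bar>) / 2) has_real_derivative c) (at x)"
    using assms(1,2) by (auto intro!: derivative_eq_intros)
  moreover have "(\<lambda>y. (f y + g y + \<bar>f y - g y\<bar>) / 2) = (\<lambda>y. max (f y) (g y))"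
    by (auto simp: max_def abs_if)
  ultimately show ?thesis by simp
qed

lemma DERIV_fmax_0: "(fmax has_real_derivative 0) (at 0)"
proof -
  have f1: "(f1 has_real_derivative 0) (at 0)"
    using DERIV_f1[of 0] by (simp add: osc_nonpos)
  moreover have "(f2 has_real_derivative 0) (at 0)"
    using f1 DERIV_mirror[of f1 0 0] by (simp add: f2_def[abs_def])
  ultimately show ?thesis
    unfolding fmax_def[abs_def] by (rule DERIV_max_of_equal) (simp add: f2_def)
qed

text \<open>
  The functions \<open>max f g - f\<close> and \<open>max f g - g\<close> are minimal at \<open>x\<close>.
\<close>
lemma not_differentiable_max:
  fixes f g :: "real \<Rightarrow> real"
  assumes f: "(f has_real_derivative c) (at x)" and g: "(g has_real_derivative d) (at x)"
    and eq: "f x = g x" and "c \<noteq> d"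
  shows "\<not> (\<lambda>y. max (f y) (g y)) differentiable (at x)"
proof
  assume "(\<lambda>y. max (f y) (g y)) differentiable (at x)"
  then obtain e where e: "((\<lambda>y. max (f y) (g y)) has_real_derivative e) (at x)"
    by (auto simp: real_differentiable_def)
  have "((\<lambda>y. max (f y) (g y) - g y) has_real_derivative e - d) (at x)"
    by (intro DERIV_diff e g)
  then have "e - d = 0"
    by (rule DERIV_local_min[of _ _ _ 1]) (auto simp: eq)
  moreover have "((\<lambda>y. max (f y) (g y) - f y) has_real_derivative e - c) (at x)"
    by (intro DERIV_diff e f)
  then have "e - c = 0"
    by (rule DERIV_local_min[of _ _ _ 1]) (auto simp: eq)
  ultimately show False using \<open>c \<noteq> d\<close> by simp
qed

lemma not_differentiable_fmax: "\<not> fmax differentiable (at (t_seq k))"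
proof -
  define h where "h = l_seq (Suc k)"
  have h: "0 < h" "h \<le> 1 / 2" and t: "t_seq k = 3 / 2 * h"
    using l_seq_le_1[of k] by (simp_all add: h_def l_seq_Suc[of k] t_seq_eq)
  have k: "t_seq k \<in> {l_seq (Suc k)..l_seq k}"
    using h by (simp add: t l_seq_Suc[of k] flip: h_def)
  have u: "t_seq k / l_seq (Suc k) = 3 / 2"
    using h by (simp add: t flip: h_def)
  \<comment> \<open>At u = 3/2 the factor 3 - 2u vanishes and w = 1/4, so \<open>bump 0\<close> is 0
    and \<open>bump 1\<close> is -12: the pieces meet with slopes differing by 12 h^3.\<close>
  have osc: "osc 0 (t_seq k) = 0" "osc 1 (t_seq k) \<noteq> 0"
    using h unfolding osc_eq[OF k] u by (simp_all add: wedge_def flip: h_def)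
  have "(f1 has_real_derivative - 2 * t_seq k + osc 1 (t_seq k)) (at (t_seq k))"
    using h t by (intro DERIV_f1) simp
  moreover have "(f2 has_real_derivative - 2 * t_seq k) (at (t_seq k))"
  proof (rule has_field_derivative_transform_within_open)
    show "((\<lambda>t. - t\<^sup>2) has_real_derivative - 2 * t_seq k) (at (t_seq k))"
      by (auto intro!: derivative_eq_intros)
  qed (use h t f2_nonneg in \<open>auto intro: open_greaterThan[of 0]\<close>)
  moreover have "f1 (t_seq k) = f2 (t_seq k)"
  proof -
    have "0 \<le> t_seq k" "t_seq k \<le> 1" using h t by simp_all
    then show ?thesis by (simp add: f1_eq f2_nonneg osc)
  qed
  ultimately show ?thesis
    unfolding fmax_def[abs_def] by (rule not_differentiable_max) (use osc in simp)
qed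

lemma t_seq_LIMSEQ: "t_seq \<longlonglongrightarrow> 0"
proof -
  have t_seq: "t_seq = (\<lambda>k. 3 / 4 * (1 / 2) ^ k)"
    by (rule ext) (simp add: t_seq_eq l_seq_def power_divide)
  have "(\<lambda>k. 3 / 4 * (1 / 2) ^ k :: real) \<longlonglongrightarrow> 3 / 4 * 0"
    by (intro tendsto_intros LIMSEQ_power_zero) simp
  then show ?thesis
    unfolding t_seq mult_zero_right .
qed

text \<open>Every neighborhood of 0 contains some \<open>t_k\<close>, so differentiability already
  fails there.\<close>

lemma not_C1_fmax: "\<not> Cq_at_on 1 fmax {-1..1} 0"
proof
  assume "Cq_at_on 1 fmax {-1..1} 0"
  then obtain U where U: "open U" "0 \<in> U" and "Cq_on 1 fmax (U \<inter> {-1..1})"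
    unfolding Cq_at_on_def by blast
  then obtain D where D: "\<forall>t\<in>U \<inter> {-1..1}. D 0 t = fmax t"
    "\<forall>j<1. \<forall>t\<in>U \<inter> {-1..1}. (D j has_real_derivative D (Suc j) t) (at t within U \<inter> {-1..1})"
    unfolding Cq_on_def by blast
  \<comment> \<open>Removing the endpoints gives an open set, on which the derivative within the set
    is the ordinary one.\<close>
  define V where "V = U \<inter> {-1<..<1}"
  have V: "open V" "0 \<in> V" "V \<subseteq> U \<inter> {-1..1}"
    using U by (auto simp: V_def)
  have "\<forall>\<^sub>F k in sequentially. t_seq k \<in> V"
    by (rule topological_tendstoD[OF t_seq_LIMSEQ V(1,2)])
  then obtain k where k: "t_seq k \<in> V"
    by (auto simp: eventually_sequentially)
  then have "t_seq k \<in> U \<inter> {-1..1}" using V(3) by (rule rev_subsetD)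
  then have "(D 0 has_real_derivative D (Suc 0) (t_seq k)) (at (t_seq k) within U \<inter> {-1..1})"
    by (rule D(2)[rule_format, OF zero_less_one])
  then have "(D 0 has_real_derivative D (Suc 0) (t_seq k)) (at (t_seq k) within V)"
    using V(3) by (rule has_field_derivative_subset)
  then have "(D 0 has_real_derivative D (Suc 0) (t_seq k)) (at (t_seq k))"
    unfolding at_within_open[OF k V(1)] .
  then have "(fmax has_real_derivative D (Suc 0) (t_seq k)) (at (t_seq k))"
  proof (rule has_field_derivative_transform_within_open)
    show "D 0 t = fmax t" if "t \<in> V" for t
      using D(1) V(3) that by (meson subsetD)
  qed (fact V(1) k)+
  then show False
    using not_differentiable_fmax[of k] unfolding real_differentiable_def by blast
qed

theorem mainTheorem6:
  shows "(\<forall>k. \<exists>!P. p_conditions k P)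
    \<and> (\<forall>k. \<forall>t \<in> {l_seq (k + 1)..l_seq k}. f1 t = poly (p_poly k) t)
    \<and> (\<forall>t \<in> {-1..0}. f1 t = - t\<^sup>2)
    \<and> Cq_on 3 f1 {-1..1}
    \<and> Cq_on 3 f2 {-1..1}
    \<and> isolated_local_maximizer_on fmax {-1..1} 0
    \<and> (\<forall>t \<in> {-1..1}. fmax t \<le> fmax 0)
    \<and> (fmax has_real_derivative 0) (at 0)
    \<and> t_seq \<longlonglongrightarrow> 0
    \<and> (\<forall>k. \<not> fmax differentiable (at (t_seq k)))
    \<and> \<not> Cq_at_on 1 fmax {-1..1} 0"
proof (intro conjI allI ballI)
  show "\<exists>!P. p_conditions k P" for k
    using p_conditions_p_sol p_conditions_unique by blast
  show "f1 t = poly (p_poly k) t" if "t \<in> {l_seq (k + 1)..l_seq k}" for k t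
    using that by (rule f1_eq_p_poly)
  show "f1 t = - t\<^sup>2" if "t \<in> {-1..0}" for t
    using that by (simp add: f1_def)
  show "Cq_on 3 f1 {-1..1}"
  proof (rule Cq_onI)
    show "(f1_deriv j has_real_derivative f1_deriv (Suc j) t) (at t)" if "j < 3" for j t
      using that by (rule DERIV_f1_deriv)
  qed (simp_all only: continuous_on_f1_deriv_3 f1_deriv_0 atLeastAtMost_iff)
  show "Cq_on 3 f2 {-1..1}"
  proof (rule Cq_on_reflect)
    show "(f1_deriv j has_real_derivative f1_deriv (Suc j) t) (at t)" if "j < 3" for j t
      using that by (rule DERIV_f1_deriv)
    show "f1_deriv 0 (- t) = f2 t" if "t \<in> {-1..1}" for t
      using that by (simp add: f1_deriv_0 f2_def)
  qed (simp only: continuous_on_f1_deriv_3)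
qed (simp_all only: isolated_local_maximizer_fmax fmax_le_fmax_0 DERIV_fmax_0 t_seq_LIMSEQ
    not_differentiable_fmax not_C1_fmax not_False_eq_True)

end
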